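(* Let $f$ be a skew-symmetric Gaussian field over $\mathbb{R}^D\times\mathbb{R}^D$ that is twice mean-square differentiable, and let $\tilde f$ be its second-order Taylor approximation at the point $z=(z^*,z^* )$. Then $\tilde f$ is also a Gaussian field. In particular, when $f$ has mean zero, the mean function of $\tilde f$ is also zero.
   Context: Let $D\ge 1$ and write points of $\mathbb{R}^D\times\mathbb{R}^D$ as $x=(x^{(1)},x^{(2)})$, with $x^{flip}=(x^{(2)},x^{(1)})$. A real-valued random field with finite second moments is Gaussian if every finite linear combination of its values is a (possibly degenerate) Gaussian random variable. A Gaussian field $f$ is skew-symmetric if, with probability one, $f(x^{flip})=-f(x)$ for all $x\in\mathbb{R}^D\times\mathbb{R}^D$. Derivatives of $f$ are taken in the mean-square ($L^2(\Omega)$) sense. Fix $z^*\in\mathbb{R}^D$ and $z=(z^*,z^* )$. Define $$g_i=\partial_{x^{(1)}_i}f(x)\big|_{x=z},\quad H^{(1,1)}_{i,j}=\partial_{x^{(1)}_i}\partial_{x^{(1)}_j}f(x)\big|_{x=z},\quad H^{(1,2)}_{i,j}=\partial_{x^{(1)}_i}\partial_{x^{(2)}_j}f(x)\big|_{x=z}.$$ The second-order (skew-symmetric) Taylor approximation of $f$ at $z$ is $$\tilde f(x)=g^{\mathsf T}(v-w)+\tfrac12\big(v^{\mathsf T}H^{(1,1)}v-w^{\mathsf T}H^{(1,1)}w\big)+v^{\mathsf T}H^{(1,2)}w,\qquad v=x^{(1)}-z^*,\ w=x^{(2)}-z^*.$$ *)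

theory Defs
  imports "HOL-Probability.Probability"
begin

definition second_order_rv :: "'w measure \<Rightarrow> ('w \<Rightarrow> real) \<Rightarrow> bool" where
  "second_order_rv M X \<longleftrightarrow> X \<in> borel_measurable M \<and> integrable M (\<lambda>\<omega>. (X \<omega>)\<^sup>2)"

definition second_order_field :: "'w measure \<Rightarrow> ('x \<Rightarrow> 'w \<Rightarrow> real) \<Rightarrow> bool" where
  "second_order_field M f \<longleftrightarrow> (\<forall>x. second_order_rv M (f x))"

(* The second disjunct is the degenerate case: a point mass at mu. *)
definition gaussian_rv :: "'w measure \<Rightarrow> ('w \<Rightarrow> real) \<Rightarrow> bool" where
  "gaussian_rv M X \<longleftrightarrow> X \<in> borel_measurable M \<and>
     ((\<exists>\<mu> \<sigma>. \<sigma> > 0 \<and> distributed M lborel X (normal_density \<mu> \<sigma>)) \<or>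
      (\<exists>\<mu>. AE \<omega> in M. X \<omega> = \<mu>))"

definition gaussian_field :: "'w measure \<Rightarrow> ('x \<Rightarrow> 'w \<Rightarrow> real) \<Rightarrow> bool" where
  "gaussian_field M f \<longleftrightarrow> second_order_field M f \<and>
     (\<forall>S c. finite S \<longrightarrow> gaussian_rv M (\<lambda>\<omega>. \<Sum>x\<in>S. c x * f x \<omega>))"

definition skew_symmetric_field :: "'w measure \<Rightarrow> ('x \<times> 'x \<Rightarrow> 'w \<Rightarrow> real) \<Rightarrow> bool" where
  "skew_symmetric_field M f \<longleftrightarrow> (AE \<omega> in M. \<forall>x. f (prod.swap x) \<omega> = - f x \<omega>)"

(* G is a version of the mean-square derivative of f at x in direction u.  Such a G is
   determined only up to almost sure equality, hence a relation.  All fields involved are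
   required to be square integrable, so the Bochner integral is a genuine second moment. *)
definition has_ms_deriv ::
  "'w measure \<Rightarrow> ('x::real_normed_vector \<Rightarrow> 'w \<Rightarrow> real) \<Rightarrow> 'x \<Rightarrow> 'x \<Rightarrow> ('w \<Rightarrow> real) \<Rightarrow> bool" where
  "has_ms_deriv M f u x G \<longleftrightarrow> second_order_field M f \<and> second_order_rv M G \<and>
     ((\<lambda>h. \<integral>\<omega>. ((f (x + h *\<^sub>R u) \<omega> - f x \<omega>) / h - G \<omega>)\<^sup>2 \<partial>M) \<longlongrightarrow> 0) (at (0::real))"

(* H is a version of the iterated derivative of f at x: first in direction v (at every point),
   then the resulting field F in direction u. *)
definition has_ms_deriv2 ::
  "'w measure \<Rightarrow> ('x::real_normed_vector \<Rightarrow> 'w \<Rightarrow> real) \<Rightarrow> 'x \<Rightarrow> 'x \<Rightarrow> 'x \<Rightarrow> ('w \<Rightarrow> real) \<Rightarrow> bool" where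
  "has_ms_deriv2 M f u v x H \<longleftrightarrow>
     (\<exists>F. (\<forall>y. has_ms_deriv M f v y (F y)) \<and> has_ms_deriv M F u x H)"

(* Basis consists of the coordinate directions, so this asks for all first and second order
   partial derivatives at all points. *)
definition twice_ms_differentiable ::
  "'w measure \<Rightarrow> ('x::euclidean_space \<Rightarrow> 'w \<Rightarrow> real) \<Rightarrow> bool" where
  "twice_ms_differentiable M f \<longleftrightarrow>
     (\<forall>u\<in>Basis. \<forall>x. \<exists>G. has_ms_deriv M f u x G) \<and>
     (\<forall>u\<in>Basis. \<forall>v\<in>Basis. \<forall>x. \<exists>H. has_ms_deriv2 M f u v x H)"

definition dir1 :: "'d::finite \<Rightarrow> (real^'d) \<times> (real^'d)" where
  "dir1 i = (axis i 1, 0)"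

definition dir2 :: "'d::finite \<Rightarrow> (real^'d) \<times> (real^'d)" where
  "dir2 i = (0, axis i 1)"

definition skew_taylor2 ::
  "real^'d \<Rightarrow> ('w \<Rightarrow> real^'d) \<Rightarrow> ('w \<Rightarrow> real^'d^'d) \<Rightarrow> ('w \<Rightarrow> real^'d^'d) \<Rightarrow>
   (real^'d) \<times> (real^'d) \<Rightarrow> 'w \<Rightarrow> real" where
  "skew_taylor2 zs g H11 H12 x \<omega> =
     (let v = fst x - zs; w = snd x - zs in
        g \<omega> \<bullet> (v - w)
        + 1/2 * (v \<bullet> (H11 \<omega> *v v) - w \<bullet> (H11 \<omega> *v w))
        + v \<bullet> (H12 \<omega> *v w))"

end

theory Submission
  imports Defs
begin

text \<open>
  All randomness of the Taylor approximation comes from mean-square derivatives of \<open>f\<close>, and these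
  are \<open>L\<^sup>2\<close>-limits of difference quotients.  Hence every value of the approximation lies in the
  Gaussian space of \<open>f\<close>: the \<open>L\<^sup>2\<close>-closure of the linear span of the random variables
  \<open>f x\<close>.  This closure is again linear and closed under \<open>L\<^sup>2\<close>-limits
  (\<open>mean_square_closure_linear\<close>, \<open>mean_square_closure_closed\<close>), so it also contains second derivatives and
  the finite linear combinations that have to be examined.

  It remains to see that each of its elements is Gaussian.  The span consists of Gaussian variables
  by hypothesis, so the point is that an \<open>L\<^sup>2\<close>-limit of Gaussian variables is Gaussian
  (\<open>gaussian_rv_L2_limit\<close>).  A square integrable \<open>X\<close> is Gaussian iff its characteristic function
  is \<open>iexp (t * m) * exp (- (t\<^sup>2 * s / 2))\<close> for its mean \<open>m\<close> and variance \<open>s\<close>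
  (\<open>gaussian_rv_iff_char\<close>).  Mean, variance and characteristic function are all continuous in
  \<open>L\<^sup>2\<close>, so this identity survives in the limit, and \<open>s = 0\<close> accounts for the limits that
  degenerate.  Continuity of the mean also shows that a centered field has a centered
  Gaussian space.
\<close>

section \<open>Square integrable random variables\<close>

lemma (in prob_space) second_order_rv_integrable:
  "second_order_rv M X \<Longrightarrow> integrable M X"
  by (rule square_integrable_imp_integrable) (auto simp: second_order_rv_def)

lemma second_order_rv_integrable_mult:
  fixes X Y :: "'w \<Rightarrow> real"
  assumes "second_order_rv M X" "second_order_rv M Y"
  shows "integrable M (\<lambda>\<omega>. X \<omega> * Y \<omega>)"
proof -
  have [measurable]: "X \<in> borel_measurable M" "Y \<in> borel_measurable M"
    using assms by (auto simp: second_order_rv_def)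
  have "integrable M (\<lambda>\<omega>. (X \<omega>)\<^sup>2 + (Y \<omega>)\<^sup>2)"
    using assms by (auto simp: second_order_rv_def)
  then show ?thesis
  proof (rule Bochner_Integration.integrable_bound)
    have "\<bar>a * b\<bar> \<le> a\<^sup>2 + b\<^sup>2" for a b :: real
    proof -
      have "2 * \<bar>a\<bar> * \<bar>b\<bar> \<le> \<bar>a\<bar>\<^sup>2 + \<bar>b\<bar>\<^sup>2"
        by (rule sum_squares_bound)
      moreover have "0 \<le> \<bar>a\<bar> * \<bar>b\<bar>" by simp
      ultimately have "\<bar>a\<bar> * \<bar>b\<bar> \<le> \<bar>a\<bar>\<^sup>2 + \<bar>b\<bar>\<^sup>2"
        by linarith
      then show ?thesis by (simp add: abs_mult)
    qed
    then show "AE \<omega> in M. norm (X \<omega> * Y \<omega>) \<le> norm ((X \<omega>)\<^sup>2 + (Y \<omega>)\<^sup>2)"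
      by simp
  qed simp
qed

lemma second_order_rv_linear:
  assumes "second_order_rv M X" "second_order_rv M Y"
  shows "second_order_rv M (\<lambda>\<omega>. a * X \<omega> + b * Y \<omega>)"
proof -
  have "integrable M (\<lambda>\<omega>. a\<^sup>2 * (X \<omega>)\<^sup>2 + 2 * a * b * (X \<omega> * Y \<omega>) + b\<^sup>2 * (Y \<omega>)\<^sup>2)"
    using assms second_order_rv_integrable_mult[OF assms] by (auto simp: second_order_rv_def)
  moreover have "(\<lambda>\<omega>. a\<^sup>2 * (X \<omega>)\<^sup>2 + 2 * a * b * (X \<omega> * Y \<omega>) + b\<^sup>2 * (Y \<omega>)\<^sup>2)
      = (\<lambda>\<omega>. (a * X \<omega> + b * Y \<omega>)\<^sup>2)"
    by (simp add: power2_eq_square algebra_simps)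
  ultimately show ?thesis
    using assms by (auto simp: second_order_rv_def)
qed

lemma second_order_rv_diff:
  "second_order_rv M X \<Longrightarrow> second_order_rv M Y \<Longrightarrow> second_order_rv M (\<lambda>\<omega>. X \<omega> - Y \<omega>)"
  using second_order_rv_linear[of M X Y 1 "-1"] by simp

lemma second_order_rv_abs:
  "second_order_rv M X \<Longrightarrow> second_order_rv M (\<lambda>\<omega>. \<bar>X \<omega>\<bar>)"
  by (auto simp: second_order_rv_def)

lemma (in prob_space) second_order_rv_const: "second_order_rv M (\<lambda>\<omega>. c)"
  by (simp add: second_order_rv_def)

lemma integral_linear_square:
  assumes "second_order_rv M X" "second_order_rv M Y"
  shows "(\<integral>\<omega>. (a * X \<omega> + b * Y \<omega>)\<^sup>2 \<partial>M)
    = a\<^sup>2 * (\<integral>\<omega>. (X \<omega>)\<^sup>2 \<partial>M) + 2 * a * b * (\<integral>\<omega>. X \<omega> * Y \<omega> \<partial>M) + b\<^sup>2 * (\<integral>\<omega>. (Y \<omega>)\<^sup>2 \<partial>M)"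
proof -
  have "(\<lambda>\<omega>. (a * X \<omega> + b * Y \<omega>)\<^sup>2)
      = (\<lambda>\<omega>. a\<^sup>2 * (X \<omega>)\<^sup>2 + 2 * a * b * (X \<omega> * Y \<omega>) + b\<^sup>2 * (Y \<omega>)\<^sup>2)"
    by (simp add: power2_eq_square algebra_simps)
  then show ?thesis
    using assms second_order_rv_integrable_mult[OF assms] by (simp add: second_order_rv_def)
qed

text \<open>
  The quadratic form \<open>(a, b) \<mapsto> E (a X + b Y)\<^sup>2\<close> is nonnegative, so its discriminant has the right sign.
\<close>

lemma Cauchy_Schwarz_second_order:
  assumes X: "second_order_rv M X" and Y: "second_order_rv M Y"
  shows "(\<integral>\<omega>. X \<omega> * Y \<omega> \<partial>M)\<^sup>2 \<le> (\<integral>\<omega>. (X \<omega>)\<^sup>2 \<partial>M) * (\<integral>\<omega>. (Y \<omega>)\<^sup>2 \<partial>M)"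
proof -
  define p q r where "p = (\<integral>\<omega>. (X \<omega>)\<^sup>2 \<partial>M)" and "q = (\<integral>\<omega>. X \<omega> * Y \<omega> \<partial>M)"
    and "r = (\<integral>\<omega>. (Y \<omega>)\<^sup>2 \<partial>M)"
  have nn: "0 \<le> a\<^sup>2 * p + 2 * a * b * q + b\<^sup>2 * r" for a b
  proof -
    have "0 \<le> (\<integral>\<omega>. (a * X \<omega> + b * Y \<omega>)\<^sup>2 \<partial>M)"
      by simp
    then show ?thesis
      unfolding integral_linear_square[OF X Y] p_def q_def r_def .
  qed
  have "0 \<le> p" "0 \<le> r"
    by (simp_all add: p_def r_def)
  have "q\<^sup>2 \<le> p * r"
  proof -
    \<comment> \<open>The form is evaluated at the vector that minimizes it along one axis, which requires a
      nonzero diagonal entry; if both vanish, its value \<open>- 2 q\<^sup>2\<close> at \<open>(1, - q)\<close> forces \<open>q = 0\<close>.\<close>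
    consider "p > 0" | "r > 0" | "p = 0" "r = 0"
      using \<open>0 \<le> p\<close> \<open>0 \<le> r\<close> by linarith
    then show ?thesis
    proof cases
      case 1
      have "0 \<le> p * (p * r - q\<^sup>2)"
        using nn[of "- q" p] by (simp add: power2_eq_square algebra_simps)
      with 1 show ?thesis by (simp add: zero_le_mult_iff)
    next
      case 2
      have "0 \<le> r * (p * r - q\<^sup>2)"
        using nn[of r "- q"] by (simp add: power2_eq_square algebra_simps)
      with 2 show ?thesis by (simp add: zero_le_mult_iff)
    next
      case 3
      with nn[of 1 "- q"] show ?thesis
        by (simp add: power2_eq_square)
    qed
  qed
  then show ?thesis by (simp add: p_def q_def r_def)
qed

lemma (in prob_space) expectation_abs_le_L2:
  assumes "second_order_rv M X"
  shows "expectation (\<lambda>\<omega>. \<bar>X \<omega>\<bar>) \<le> sqrt (expectation (\<lambda>\<omega>. (X \<omega>)\<^sup>2))"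
  using Cauchy_Schwarz_second_order[OF second_order_rv_abs[OF assms] second_order_rv_const[of 1]]
  by (intro real_le_rsqrt) (simp add: prob_space)

section \<open>Continuity of moments and characteristic functions in mean square\<close>

text \<open>
  Expectations and characteristic functions are Lipschitz for the \<open>L\<^sup>1\<close>-distance, so for them
  it suffices that \<open>L\<^sup>2\<close>-convergence implies \<open>L\<^sup>1\<close>-convergence on a probability space.
\<close>

lemma (in prob_space) expectation_L1_tendsto:
  assumes X: "second_order_rv M X" and Y: "\<And>n. second_order_rv M (Y n)"
    and lim: "(\<lambda>n. expectation (\<lambda>\<omega>. (X \<omega> - Y n \<omega>)\<^sup>2)) \<longlonglongrightarrow> 0"
  shows "(\<lambda>n. expectation (\<lambda>\<omega>. \<bar>X \<omega> - Y n \<omega>\<bar>)) \<longlonglongrightarrow> 0"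
proof (rule Lim_null_comparison)
  show "(\<lambda>n. sqrt (expectation (\<lambda>\<omega>. (X \<omega> - Y n \<omega>)\<^sup>2))) \<longlonglongrightarrow> 0"
    using tendsto_real_sqrt[OF lim] by simp
  show "\<forall>\<^sub>F n in sequentially. norm (expectation (\<lambda>\<omega>. \<bar>X \<omega> - Y n \<omega>\<bar>))
      \<le> sqrt (expectation (\<lambda>\<omega>. (X \<omega> - Y n \<omega>)\<^sup>2))"
    using expectation_abs_le_L2[OF second_order_rv_diff[OF X Y]] by simp
qed

lemma (in prob_space) expectation_tendsto_L2:
  assumes X: "second_order_rv M X" and Y: "\<And>n. second_order_rv M (Y n)"
    and lim: "(\<lambda>n. expectation (\<lambda>\<omega>. (X \<omega> - Y n \<omega>)\<^sup>2)) \<longlonglongrightarrow> 0"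
  shows "(\<lambda>n. expectation (Y n)) \<longlonglongrightarrow> expectation X"
proof -
  have "norm (expectation (Y n) - expectation X) \<le> expectation (\<lambda>\<omega>. \<bar>X \<omega> - Y n \<omega>\<bar>)" for n
  proof -
    have "expectation (\<lambda>\<omega>. X \<omega> - Y n \<omega>) = expectation X - expectation (Y n)"
      by (intro Bochner_Integration.integral_diff second_order_rv_integrable X Y)
    then show ?thesis
      using integral_norm_bound[of M "\<lambda>\<omega>. X \<omega> - Y n \<omega>"] by (simp add: abs_minus_commute)
  qed
  then have "(\<lambda>n. expectation (Y n) - expectation X) \<longlonglongrightarrow> 0"
    by (intro Lim_null_comparison[OF always_eventually expectation_L1_tendsto[OF assms]]) simp
  then show ?thesis
    by (rule LIM_zero_cancel)
qed

text \<open>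
  Expanding \<open>Y\<^sub>n = X - (X - Y\<^sub>n)\<close> leaves the cross term \<open>E X (X - Y\<^sub>n)\<close>, which vanishes in
  the limit by the Cauchy-Schwarz inequality.
\<close>

lemma (in prob_space) second_moment_tendsto_L2:
  assumes X: "second_order_rv M X" and Y: "\<And>n. second_order_rv M (Y n)"
    and lim: "(\<lambda>n. expectation (\<lambda>\<omega>. (X \<omega> - Y n \<omega>)\<^sup>2)) \<longlonglongrightarrow> 0"
  shows "(\<lambda>n. expectation (\<lambda>\<omega>. (Y n \<omega>)\<^sup>2)) \<longlonglongrightarrow> expectation (\<lambda>\<omega>. (X \<omega>)\<^sup>2)"
proof -
  define d c where "d n = expectation (\<lambda>\<omega>. (X \<omega> - Y n \<omega>)\<^sup>2)"
    and "c n = expectation (\<lambda>\<omega>. X \<omega> * (X \<omega> - Y n \<omega>))" for n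
  note diff = second_order_rv_diff[OF X Y]
  have "c \<longlonglongrightarrow> 0"
  proof (rule Lim_null_comparison)
    show "\<forall>\<^sub>F n in sequentially. norm (c n) \<le> sqrt (expectation (\<lambda>\<omega>. (X \<omega>)\<^sup>2) * d n)"
      using Cauchy_Schwarz_second_order[OF X diff]
      by (auto intro!: always_eventually real_le_rsqrt simp: c_def d_def)
    show "(\<lambda>n. sqrt (expectation (\<lambda>\<omega>. (X \<omega>)\<^sup>2) * d n)) \<longlonglongrightarrow> 0"
      using tendsto_real_sqrt[OF tendsto_mult[OF tendsto_const lim]] by (simp add: d_def)
  qed
  moreover have "expectation (\<lambda>\<omega>. (Y n \<omega>)\<^sup>2) = expectation (\<lambda>\<omega>. (X \<omega>)\<^sup>2) - 2 * c n + d n" for n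
    using integral_linear_square[OF X diff, of 1 "- 1" n] by (simp add: c_def d_def)
  moreover have "d \<longlonglongrightarrow> 0"
    using lim by (simp add: d_def[abs_def])
  ultimately show ?thesis
    using tendsto_add[OF tendsto_diff[OF tendsto_const tendsto_mult[OF tendsto_const]], of c 0 sequentially d 0
        "expectation (\<lambda>\<omega>. (X \<omega>)\<^sup>2)" 2] by simp
qed

lemma (in prob_space) variance_tendsto_L2:
  assumes X: "second_order_rv M X" and Y: "\<And>n. second_order_rv M (Y n)"
    and lim: "(\<lambda>n. expectation (\<lambda>\<omega>. (X \<omega> - Y n \<omega>)\<^sup>2)) \<longlonglongrightarrow> 0"
  shows "(\<lambda>n. variance (Y n)) \<longlonglongrightarrow> variance X"
proof -
  have "variance Z = expectation (\<lambda>\<omega>. (Z \<omega>)\<^sup>2) - (expectation Z)\<^sup>2" if "second_order_rv M Z" for Z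
    using that second_order_rv_integrable[OF that] by (intro variance_eq) (auto simp: second_order_rv_def)
  moreover have "(\<lambda>n. expectation (\<lambda>\<omega>. (Y n \<omega>)\<^sup>2) - (expectation (Y n))\<^sup>2)
      \<longlonglongrightarrow> expectation (\<lambda>\<omega>. (X \<omega>)\<^sup>2) - (expectation X)\<^sup>2"
    by (intro tendsto_diff tendsto_power second_moment_tendsto_L2[OF assms]
        expectation_tendsto_L2[OF assms])
  ultimately show ?thesis
    using X Y by simp
qed

lemma norm_iexp_diff_le: "norm (iexp x - iexp y) \<le> \<bar>x - y\<bar>"
proof -
  have "iexp x - iexp y = iexp y * (iexp (x - y) - 1)"
    by (simp add: algebra_simps exp_add[symmetric] del: of_real_mult)
  then have "norm (iexp x - iexp y) = norm (iexp (x - y) - 1)"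
    by (simp add: norm_mult del: of_real_diff)
  also have "\<dots> \<le> \<bar>x - y\<bar>"
    using iexp_approx1[of "x - y" 0] by simp
  finally show ?thesis .
qed

lemma (in prob_space) char_tendsto_L2:
  assumes X: "second_order_rv M X" and Y: "\<And>n. second_order_rv M (Y n)"
    and lim: "(\<lambda>n. expectation (\<lambda>\<omega>. (X \<omega> - Y n \<omega>)\<^sup>2)) \<longlonglongrightarrow> 0"
  shows "(\<lambda>n. char (distr M borel (Y n)) t) \<longlonglongrightarrow> char (distr M borel X) t"
proof -
  have [measurable]: "X \<in> borel_measurable M" "Y n \<in> borel_measurable M" for n
    using X Y by (auto simp: second_order_rv_def)
  have bound: "norm (char (distr M borel (Y n)) t - char (distr M borel X) t)
      \<le> \<bar>t\<bar> * expectation (\<lambda>\<omega>. \<bar>X \<omega> - Y n \<omega>\<bar>)" for n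
  proof -
    have int: "integrable M (\<lambda>\<omega>. iexp (t * X \<omega>))" "integrable M (\<lambda>\<omega>. iexp (t * Y n \<omega>))"
      by (auto intro!: integrable_iexp simp del: of_real_mult)
    have "char (distr M borel (Y n)) t - char (distr M borel X) t
        = (CLINT \<omega>|M. iexp (t * Y n \<omega>) - iexp (t * X \<omega>))"
      unfolding char_def using int by (simp add: integral_distr del: of_real_mult)
    also have "norm \<dots> \<le> expectation (\<lambda>\<omega>. norm (iexp (t * Y n \<omega>) - iexp (t * X \<omega>)))"
      by (rule integral_norm_bound)
    also have "\<dots> \<le> expectation (\<lambda>\<omega>. \<bar>t\<bar> * \<bar>X \<omega> - Y n \<omega>\<bar>)"
    proof (rule integral_mono)
      show "integrable M (\<lambda>\<omega>. \<bar>t\<bar> * \<bar>X \<omega> - Y n \<omega>\<bar>)"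
        using second_order_rv_integrable[OF second_order_rv_diff[OF X Y[of n]]] by auto
      show "norm (iexp (t * Y n \<omega>) - iexp (t * X \<omega>)) \<le> \<bar>t\<bar> * \<bar>X \<omega> - Y n \<omega>\<bar>" for \<omega>
        using norm_iexp_diff_le[of "t * Y n \<omega>" "t * X \<omega>"]
        by (simp add: abs_mult[symmetric] right_diff_distrib abs_minus_commute)
    qed (use int in auto)
    finally show ?thesis by simp
  qed
  have null: "(\<lambda>n. \<bar>t\<bar> * expectation (\<lambda>\<omega>. \<bar>X \<omega> - Y n \<omega>\<bar>)) \<longlonglongrightarrow> 0"
    using tendsto_mult[OF tendsto_const expectation_L1_tendsto[OF assms]] by simp
  have "(\<lambda>n. char (distr M borel (Y n)) t - char (distr M borel X) t) \<longlonglongrightarrow> 0"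
    by (rule Lim_null_comparison[OF always_eventually null]) (simp add: bound)
  then show ?thesis
    by (rule LIM_zero_cancel)
qed

section \<open>Gaussian random variables by their characteristic functions\<close>

lemma (in prob_space) char_normal:
  assumes \<sigma>: "\<sigma> > 0" and D: "distributed M lborel X (normal_density \<mu> \<sigma>)"
  shows "char (distr M borel X) t = iexp (t * \<mu>) * exp (- (t\<^sup>2 * \<sigma>\<^sup>2 / 2))"
proof -
  define Z where "Z \<omega> = (X \<omega> - \<mu>) / \<sigma>" for \<omega>
  have X_eq: "X \<omega> = \<mu> + \<sigma> * Z \<omega>" for \<omega>
    using \<sigma> by (simp add: Z_def)
  have [measurable]: "X \<in> borel_measurable M"
    using distributed_measurable[OF D] by simp
  then have [measurable]: "Z \<in> borel_measurable M"
    unfolding Z_def by measurable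
  have DZ: "distributed M lborel Z std_normal_density"
    using D normal_standard_normal_convert[OF \<sigma>, of X \<mu>] by (simp add: Z_def[abs_def])
  have dZ: "distr M borel Z = std_normal_distribution"
    using distributed_distr_eq_density[OF DZ] by (simp cong: distr_cong)
  have "char (distr M borel X) t = (CLINT \<omega>|M. iexp (t * \<mu>) * iexp ((t * \<sigma>) * Z \<omega>))"
    unfolding char_def
    by (subst integral_distr) (simp_all add: X_eq exp_add[symmetric] algebra_simps)
  also have "\<dots> = iexp (t * \<mu>) * char (distr M borel Z) (t * \<sigma>)"
    unfolding char_def by (simp add: integral_distr del: of_real_mult)
  finally show ?thesis
    unfolding dZ char_std_normal_distribution by (simp add: power_mult_distrib)
qed

text \<open>
  One direction computes the characteristic functions of normal laws and point masses.  Conversely,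
  positive variance determines a normal law with this characteristic function, and Levy's
  uniqueness theorem identifies it with the law of \<open>X\<close>; zero variance makes \<open>X\<close> almost surely
  equal to its mean.  The single formula covers both kinds of Gaussian variable, which is what makes
  it stable under limits.
\<close>

lemma (in prob_space) gaussian_rv_iff_char:
  assumes X: "second_order_rv M X"
  shows "gaussian_rv M X \<longleftrightarrow>
    (\<forall>t. char (distr M borel X) t = iexp (t * expectation X) * exp (- (t\<^sup>2 * variance X / 2)))"
proof
  have [measurable]: "X \<in> borel_measurable M"
    using X by (simp add: second_order_rv_def)
  assume "gaussian_rv M X"
  then consider (normal) \<mu> \<sigma> where "\<sigma> > 0" "distributed M lborel X (normal_density \<mu> \<sigma>)"
    | (const) \<mu> where "AE \<omega> in M. X \<omega> = \<mu>"
    unfolding gaussian_rv_def by blast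
  then show "\<forall>t. char (distr M borel X) t = iexp (t * expectation X) * exp (- (t\<^sup>2 * variance X / 2))"
  proof cases
    case normal
    then show ?thesis
      using char_normal normal_distributed_expectation normal_distributed_variance by simp
  next
    case const
    have E: "expectation X = \<mu>"
      using const by (subst integral_cong_AE[where g = "\<lambda>_. \<mu>"]) (auto simp: prob_space)
    have "variance X = 0"
      unfolding E using const by (subst integral_cong_AE[where g = "\<lambda>_. 0"]) auto
    moreover have "char (distr M borel X) t = iexp (t * \<mu>)" for t
      unfolding char_def using const
      by (subst integral_distr, simp, simp, subst integral_cong_AE[where g = "\<lambda>_. iexp (t * \<mu>)"])
         (auto simp: prob_space)
    ultimately show ?thesis using E by simp
  qed
next
  have [measurable]: "X \<in> borel_measurable M"
    using X by (simp add: second_order_rv_def)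
  assume char: "\<forall>t. char (distr M borel X) t
    = iexp (t * expectation X) * exp (- (t\<^sup>2 * variance X / 2))"
  show "gaussian_rv M X"
  proof (cases "variance X = 0")
    case True
    have "integrable M (\<lambda>\<omega>. (X \<omega> - expectation X)\<^sup>2)"
      using second_order_rv_diff[OF X second_order_rv_const[of "expectation X"]]
      by (simp add: second_order_rv_def)
    with True have "AE \<omega> in M. X \<omega> = expectation X"
      using integral_nonneg_eq_0_iff_AE[of M "\<lambda>\<omega>. (X \<omega> - expectation X)\<^sup>2"] by simp
    then show ?thesis
      unfolding gaussian_rv_def by auto
  next
    case False
    define \<sigma> where "\<sigma> = sqrt (variance X)"
    define N where "N = density lborel (normal_density (expectation X) \<sigma>)"
    have "variance X > 0"
      using False variance_positive[of X] by linarith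
    then have \<sigma>: "\<sigma> > 0" and \<sigma>2: "\<sigma>\<^sup>2 = variance X"
      by (auto simp: \<sigma>_def)
    \<comment> \<open>On \<open>N\<close> the identity is a normal variable, so its characteristic function is already known.\<close>
    interpret N: prob_space N
      unfolding N_def by (rule prob_space_normal_density[OF \<sigma>])
    have D: "distributed N lborel (\<lambda>x. x) (normal_density (expectation X) \<sigma>)"
      unfolding distributed_def N_def by (auto simp: distr_id2)
    have "distr N borel (\<lambda>x. x) = N"
      by (rule distr_id2) (simp add: N_def)
    then have charN: "char N t = iexp (t * expectation X) * exp (- (t\<^sup>2 * variance X / 2))" for t
      using N.char_normal[OF \<sigma> D, of t] by (simp add: \<sigma>2)
    have "distr M borel X = N"
    proof (rule Levy_uniqueness)
      show "real_distribution N"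
        unfolding real_distribution_def real_distribution_axioms_def
        using N.prob_space_axioms by (simp add: N_def)
      show "char (distr M borel X) = char N"
        using char charN by (auto simp: fun_eq_iff)
    qed simp
    then have "distributed M lborel X (normal_density (expectation X) \<sigma>)"
      unfolding distributed_def N_def by (simp cong: distr_cong)
    then show ?thesis
      unfolding gaussian_rv_def using \<sigma> by auto
  qed
qed

text \<open>
  Both sides of the characteristic function identity pass to the limit.  The variances may tend to
  \<open>0\<close>, which is why degenerate Gaussian variables cannot be excluded.
\<close>

lemma (in prob_space) gaussian_rv_L2_limit:
  assumes X: "second_order_rv M X" and Y: "\<And>n. second_order_rv M (Y n)"
    and lim: "(\<lambda>n. expectation (\<lambda>\<omega>. (X \<omega> - Y n \<omega>)\<^sup>2)) \<longlonglongrightarrow> 0"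
    and gauss: "\<And>n. gaussian_rv M (Y n)"
  shows "gaussian_rv M X"
  unfolding gaussian_rv_iff_char[OF X]
proof
  fix t
  have "char (distr M borel (Y n)) t
      = iexp (t * expectation (Y n)) * exp (- (t\<^sup>2 * variance (Y n) / 2))" for n
    using gauss gaussian_rv_iff_char[OF Y] by blast
  then have "(\<lambda>n. iexp (t * expectation (Y n)) * exp (- (t\<^sup>2 * variance (Y n) / 2)))
      \<longlonglongrightarrow> char (distr M borel X) t"
    using char_tendsto_L2[OF X Y lim, of t] by simp
  moreover have "(\<lambda>n. iexp (t * expectation (Y n)) * exp (- (t\<^sup>2 * variance (Y n) / 2)))
      \<longlonglongrightarrow> iexp (t * expectation X) * exp (- (t\<^sup>2 * variance X / 2))"
    by (intro tendsto_intros expectation_tendsto_L2[OF X Y lim] variance_tendsto_L2[OF X Y lim])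
       simp
  ultimately show "char (distr M borel X) t
      = iexp (t * expectation X) * exp (- (t\<^sup>2 * variance X / 2))"
    by (rule LIMSEQ_unique)
qed

section \<open>Linear spaces of random variables and their mean-square closure\<close>

text \<open>
  The closure is formed among functions and not among classes modulo almost sure equality, so it
  contains every random variable almost surely equal to one of its elements, in particular every
  version of a derivative.
\<close>

definition mean_square_closure :: "'w measure \<Rightarrow> ('w \<Rightarrow> real) set \<Rightarrow> ('w \<Rightarrow> real) set" where
  "mean_square_closure M V = {X. second_order_rv M X \<and> (\<forall>e>0. \<exists>Y\<in>V. (\<integral>\<omega>. (X \<omega> - Y \<omega>)\<^sup>2 \<partial>M) < e)}"

definition linear_rv_space :: "'w measure \<Rightarrow> ('w \<Rightarrow> real) set \<Rightarrow> bool" where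
  "linear_rv_space M V \<longleftrightarrow> (\<forall>X\<in>V. second_order_rv M X) \<and> (\<lambda>\<omega>. 0) \<in> V \<and>
     (\<forall>X\<in>V. \<forall>Y\<in>V. \<forall>a b. (\<lambda>\<omega>. a * X \<omega> + b * Y \<omega>) \<in> V)"

text \<open>
  A substitute for the triangle inequality in \<open>L\<^sup>2\<close> that avoids square roots, by the parallelogram law.
\<close>

lemma integral_add_square_le:
  assumes X: "second_order_rv M X" and Y: "second_order_rv M Y"
  shows "(\<integral>\<omega>. (X \<omega> + Y \<omega>)\<^sup>2 \<partial>M) \<le> 2 * (\<integral>\<omega>. (X \<omega>)\<^sup>2 \<partial>M) + 2 * (\<integral>\<omega>. (Y \<omega>)\<^sup>2 \<partial>M)"
proof -
  have "0 \<le> (\<integral>\<omega>. (X \<omega> - Y \<omega>)\<^sup>2 \<partial>M)"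
    by simp
  moreover have "(\<integral>\<omega>. (X \<omega> - Y \<omega>)\<^sup>2 \<partial>M)
      = (\<integral>\<omega>. (X \<omega>)\<^sup>2 \<partial>M) - 2 * (\<integral>\<omega>. X \<omega> * Y \<omega> \<partial>M) + (\<integral>\<omega>. (Y \<omega>)\<^sup>2 \<partial>M)"
    using integral_linear_square[OF X Y, of 1 "-1"] by simp
  moreover have "(\<integral>\<omega>. (X \<omega> + Y \<omega>)\<^sup>2 \<partial>M)
      = (\<integral>\<omega>. (X \<omega>)\<^sup>2 \<partial>M) + 2 * (\<integral>\<omega>. X \<omega> * Y \<omega> \<partial>M) + (\<integral>\<omega>. (Y \<omega>)\<^sup>2 \<partial>M)"
    using integral_linear_square[OF X Y, of 1 1] by simp
  ultimately show ?thesis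
    by linarith
qed

lemma mean_square_closure_incl:
  "linear_rv_space M V \<Longrightarrow> X \<in> V \<Longrightarrow> X \<in> mean_square_closure M V"
  unfolding mean_square_closure_def linear_rv_space_def by (auto intro!: bexI[of _ X])

lemma mean_square_closure_closed:
  assumes V: "linear_rv_space M V" and X: "second_order_rv M X"
    and approx: "\<And>e. e > 0 \<Longrightarrow> \<exists>Y\<in>mean_square_closure M V. (\<integral>\<omega>. (X \<omega> - Y \<omega>)\<^sup>2 \<partial>M) < e"
  shows "X \<in> mean_square_closure M V"
  unfolding mean_square_closure_def mem_Collect_eq
proof (intro conjI X allI impI)
  fix e :: real assume "e > 0"
  then obtain Y where Y: "Y \<in> mean_square_closure M V" "(\<integral>\<omega>. (X \<omega> - Y \<omega>)\<^sup>2 \<partial>M) < e / 4"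
    using approx[of "e / 4"] by auto
  then obtain Z where Z: "Z \<in> V" "(\<integral>\<omega>. (Y \<omega> - Z \<omega>)\<^sup>2 \<partial>M) < e / 4"
    using \<open>e > 0\<close> unfolding mean_square_closure_def by (auto dest: spec[of _ "e / 4"])
  have "second_order_rv M Y" "second_order_rv M Z"
    using Y Z V by (auto simp: mean_square_closure_def linear_rv_space_def)
  then have "(\<integral>\<omega>. (X \<omega> - Z \<omega>)\<^sup>2 \<partial>M) < e"
    using integral_add_square_le[OF second_order_rv_diff second_order_rv_diff, of M X Y Y Z] X Y Z
    by simp
  then show "\<exists>Z\<in>V. (\<integral>\<omega>. (X \<omega> - Z \<omega>)\<^sup>2 \<partial>M) < e"
    using Z by blast
qed

lemma mean_square_closure_second_order: "X \<in> mean_square_closure M V \<Longrightarrow> second_order_rv M X"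
  by (simp add: mean_square_closure_def)

lemma mean_square_closure_sequence:
  assumes "X \<in> mean_square_closure M V"
  obtains Y where "\<And>n. Y n \<in> V" "(\<lambda>n. \<integral>\<omega>. (X \<omega> - Y n \<omega>)\<^sup>2 \<partial>M) \<longlonglongrightarrow> 0"
proof -
  have "\<exists>Y\<in>V. (\<integral>\<omega>. (X \<omega> - Y \<omega>)\<^sup>2 \<partial>M) < 1 / real (Suc n)" for n
    using assms unfolding mean_square_closure_def by simp
  then obtain Y where Y: "\<And>n. Y n \<in> V" "\<And>n. (\<integral>\<omega>. (X \<omega> - Y n \<omega>)\<^sup>2 \<partial>M) < 1 / real (Suc n)"
    by metis
  have "(\<lambda>n. \<integral>\<omega>. (X \<omega> - Y n \<omega>)\<^sup>2 \<partial>M) \<longlonglongrightarrow> 0"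
  proof (rule Lim_null_comparison)
    show "\<forall>\<^sub>F n in sequentially. norm (\<integral>\<omega>. (X \<omega> - Y n \<omega>)\<^sup>2 \<partial>M) \<le> 1 / real (Suc n)"
      using Y(2) by (auto intro!: always_eventually less_imp_le)
    show "(\<lambda>n. 1 / real (Suc n)) \<longlonglongrightarrow> 0"
      using LIMSEQ_inverse_real_of_nat by (simp add: inverse_eq_divide)
  qed
  with Y(1) show ?thesis by (rule that)
qed

text \<open>Approximants of \<open>X\<close> and \<open>Y\<close> combine to an approximant of \<open>a X + b Y\<close>.\<close>

lemma mean_square_closure_linear:
  assumes V: "linear_rv_space M V" and X: "X \<in> mean_square_closure M V" and Y: "Y \<in> mean_square_closure M V"
  shows "(\<lambda>\<omega>. a * X \<omega> + b * Y \<omega>) \<in> mean_square_closure M V"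
  unfolding mean_square_closure_def mem_Collect_eq
proof (intro conjI allI impI)
  have X2: "second_order_rv M X" and Y2: "second_order_rv M Y"
    using X Y by (auto simp: mean_square_closure_def)
  then show "second_order_rv M (\<lambda>\<omega>. a * X \<omega> + b * Y \<omega>)"
    by (rule second_order_rv_linear)
  fix e :: real assume e: "e > 0"
  \<comment> \<open>The combined error is at most \<open>(2 a\<^sup>2 + 2 b\<^sup>2) \<delta>\<close>;
    the summand \<open>1\<close> makes \<open>e\<close> a strict bound and covers \<open>a = b = 0\<close>.\<close>
  define \<delta> where "\<delta> = e / (2 * a\<^sup>2 + 2 * b\<^sup>2 + 1)"
  have pos: "2 * a\<^sup>2 + 2 * b\<^sup>2 + 1 > 0"
    by (simp add: add_nonneg_pos)
  with e have "\<delta> > 0" by (simp add: \<delta>_def)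
  with X Y obtain X' Y' where X': "X' \<in> V" "(\<integral>\<omega>. (X \<omega> - X' \<omega>)\<^sup>2 \<partial>M) < \<delta>"
    and Y': "Y' \<in> V" "(\<integral>\<omega>. (Y \<omega> - Y' \<omega>)\<^sup>2 \<partial>M) < \<delta>"
    unfolding mean_square_closure_def by blast
  have X'2: "second_order_rv M X'" and Y'2: "second_order_rv M Y'"
    using X' Y' V by (auto simp: linear_rv_space_def)
  have "(\<integral>\<omega>. (a * X \<omega> + b * Y \<omega> - (a * X' \<omega> + b * Y' \<omega>))\<^sup>2 \<partial>M)
      = (\<integral>\<omega>. (a * (X \<omega> - X' \<omega>) + b * (Y \<omega> - Y' \<omega>))\<^sup>2 \<partial>M)"
    by (simp add: algebra_simps)
  also have "\<dots> \<le> 2 * (\<integral>\<omega>. (a * (X \<omega> - X' \<omega>))\<^sup>2 \<partial>M) + 2 * (\<integral>\<omega>. (b * (Y \<omega> - Y' \<omega>))\<^sup>2 \<partial>M)"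
    using second_order_rv_linear[OF second_order_rv_diff[OF X2 X'2] second_order_rv_diff[OF X2 X'2], of a 0]
      second_order_rv_linear[OF second_order_rv_diff[OF Y2 Y'2] second_order_rv_diff[OF Y2 Y'2], of b 0]
    by (intro integral_add_square_le) simp_all
  also have "\<dots> = 2 * a\<^sup>2 * (\<integral>\<omega>. (X \<omega> - X' \<omega>)\<^sup>2 \<partial>M) + 2 * b\<^sup>2 * (\<integral>\<omega>. (Y \<omega> - Y' \<omega>)\<^sup>2 \<partial>M)"
    by (simp add: power_mult_distrib)
  also have "\<dots> \<le> 2 * a\<^sup>2 * \<delta> + 2 * b\<^sup>2 * \<delta>"
    using X' Y' by (intro add_mono mult_left_mono) auto
  also have "\<dots> < (2 * a\<^sup>2 + 2 * b\<^sup>2 + 1) * \<delta>"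
    using \<open>\<delta> > 0\<close> by (simp add: algebra_simps)
  also have "\<dots> = e"
    using pos by (simp add: \<delta>_def)
  finally show "\<exists>Z\<in>V. (\<integral>\<omega>. (a * X \<omega> + b * Y \<omega> - Z \<omega>)\<^sup>2 \<partial>M) < e"
    using V X' Y' unfolding linear_rv_space_def by (intro bexI[of _ "\<lambda>\<omega>. a * X' \<omega> + b * Y' \<omega>"]) auto
qed

lemma mean_square_closure_linear_rv_space:
  assumes V: "linear_rv_space M V"
  shows "linear_rv_space M (mean_square_closure M V)"
proof -
  have "(\<lambda>\<omega>. 0) \<in> mean_square_closure M V"
    using V by (intro mean_square_closure_incl[OF V]) (simp add: linear_rv_space_def)
  then show ?thesis
    unfolding linear_rv_space_def[of M "mean_square_closure M V"]
    by (intro conjI ballI allI mean_square_closure_second_order mean_square_closure_linear[OF V])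
qed

lemma linear_rv_space_linear:
  assumes "linear_rv_space M V" "X \<in> V" "Y \<in> V"
  shows "(\<lambda>\<omega>. a * X \<omega> + b * Y \<omega>) \<in> V"
  using assms by (simp add: linear_rv_space_def)

lemma linear_rv_space_sum:
  assumes V: "linear_rv_space M V" and X: "\<And>i. i \<in> I \<Longrightarrow> X i \<in> V"
  shows "(\<lambda>\<omega>. \<Sum>i\<in>I. c i * X i \<omega>) \<in> V"
  using X
proof (induction I rule: infinite_finite_induct)
  case (insert i I)
  then have "X i \<in> V" "(\<lambda>\<omega>. \<Sum>i\<in>I. c i * X i \<omega>) \<in> V"
    by auto
  then have "(\<lambda>\<omega>. c i * X i \<omega> + 1 * (\<Sum>i\<in>I. c i * X i \<omega>)) \<in> V"
    by (rule linear_rv_space_linear[OF V])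
  with insert show ?case by simp
qed (use V in \<open>auto simp: linear_rv_space_def\<close>)

text \<open>
  A difference quotient of \<open>f\<close> is a linear combination of two values of \<open>f\<close>, and the closure
  contains the limits of such quotients.  Since only \<open>f y\<close> in the closure is assumed, and not in
  \<open>V\<close>, the lemma applies again to a field of derivatives.
\<close>

lemma has_ms_deriv_in_mean_square_closure:
  assumes V: "linear_rv_space M V" and f: "\<And>y. f y \<in> mean_square_closure M V"
    and deriv: "has_ms_deriv M f u x G"
  shows "G \<in> mean_square_closure M V"
proof (rule mean_square_closure_closed[OF V])
  show "second_order_rv M G"
    using deriv by (simp add: has_ms_deriv_def)
  fix e :: real assume "e > 0"
  define Q where "Q h \<omega> = (f (x + h *\<^sub>R u) \<omega> - f x \<omega>) / h" for h \<omega>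
  have "((\<lambda>h. \<integral>\<omega>. (Q h \<omega> - G \<omega>)\<^sup>2 \<partial>M) \<longlongrightarrow> 0) (at 0)"
    using deriv by (simp add: has_ms_deriv_def Q_def)
  then have "\<forall>\<^sub>F h in at 0. (\<integral>\<omega>. (Q h \<omega> - G \<omega>)\<^sup>2 \<partial>M) < e"
    using \<open>e > 0\<close> by (rule order_tendstoD)
  then obtain h where "(\<integral>\<omega>. (Q h \<omega> - G \<omega>)\<^sup>2 \<partial>M) < e"
    by (meson eventually_happens trivial_limit_at)
  moreover have "Q h \<in> mean_square_closure M V"
    using mean_square_closure_linear[OF V f[of "x + h *\<^sub>R u"] f[of x], of "1 / h" "- 1 / h"]
    by (simp add: Q_def[abs_def] diff_divide_distrib)
  ultimately show "\<exists>Y\<in>mean_square_closure M V. (\<integral>\<omega>. (G \<omega> - Y \<omega>)\<^sup>2 \<partial>M) < e"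
    by (intro bexI[of _ "Q h"]) (simp_all add: power2_commute)
qed

lemma has_ms_deriv2_in_mean_square_closure:
  assumes V: "linear_rv_space M V" and f: "\<And>y. f y \<in> mean_square_closure M V"
    and "has_ms_deriv2 M f u v x H"
  shows "H \<in> mean_square_closure M V"
  using assms unfolding has_ms_deriv2_def by (blast intro: has_ms_deriv_in_mean_square_closure)

section \<open>The Gaussian space of a Gaussian field\<close>

definition field_span :: "('x \<Rightarrow> 'w \<Rightarrow> real) \<Rightarrow> ('w \<Rightarrow> real) set" where
  "field_span f = {(\<lambda>\<omega>. \<Sum>x\<in>S. c x * f x \<omega>) | S c. finite S}"

lemma field_span_linear:
  assumes f: "second_order_field M f"
  shows "linear_rv_space M (field_span f)"
  unfolding linear_rv_space_def
proof (intro conjI ballI allI)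
  show "(\<lambda>\<omega>. 0) \<in> field_span f"
    unfolding field_span_def by (auto intro!: exI[of _ "{}"])
next
  fix X assume "X \<in> field_span f"
  then obtain S c where "finite S" and X: "X = (\<lambda>\<omega>. \<Sum>x\<in>S. c x * f x \<omega>)"
    by (auto simp: field_span_def)
  from \<open>finite S\<close> show "second_order_rv M X"
    unfolding X
  proof induction
    case (insert x S)
    then show ?case
      using second_order_rv_linear[of M "f x" _ "c x" 1] f by (simp add: second_order_field_def)
  qed (simp add: second_order_rv_def)
next
  fix X Y a b assume "X \<in> field_span f" "Y \<in> field_span f"
  then obtain S c T d where fin: "finite S" "finite T"
    and X: "X = (\<lambda>\<omega>. \<Sum>x\<in>S. c x * f x \<omega>)" and Y: "Y = (\<lambda>\<omega>. \<Sum>x\<in>T. d x * f x \<omega>)"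
    by (auto simp: field_span_def)
  define k where "k x = a * (if x \<in> S then c x else 0) + b * (if x \<in> T then d x else 0)" for x
  \<comment> \<open>The two index sets may overlap, so coefficients are extended by zero to the union.\<close>
  have "a * X \<omega> + b * Y \<omega> = (\<Sum>x\<in>S \<union> T. k x * f x \<omega>)" for \<omega>
  proof -
    have "X \<omega> = (\<Sum>x\<in>S \<union> T. (if x \<in> S then c x else 0) * f x \<omega>)"
      unfolding X using fin by (intro sum.mono_neutral_cong_left) auto
    moreover have "Y \<omega> = (\<Sum>x\<in>S \<union> T. (if x \<in> T then d x else 0) * f x \<omega>)"
      unfolding Y using fin by (intro sum.mono_neutral_cong_left) auto
    ultimately show ?thesis
      by (simp add: k_def sum_distrib_left sum.distrib algebra_simps del: if_distrib)
  qed
  then show "(\<lambda>\<omega>. a * X \<omega> + b * Y \<omega>) \<in> field_span f"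
    unfolding field_span_def using fin by (auto intro!: exI[of _ "S \<union> T"] exI[of _ k])
qed

lemma field_in_field_span: "f x \<in> field_span f"
  unfolding field_span_def by (auto intro!: exI[of _ "{x}"] exI[of _ "\<lambda>_. 1"])

lemma (in prob_space) gaussian_rv_mean_square_closure_field_span:
  assumes f: "gaussian_field M f" and X: "X \<in> mean_square_closure M (field_span f)"
  shows "gaussian_rv M X"
proof -
  have V: "linear_rv_space M (field_span f)"
    using f by (simp add: gaussian_field_def field_span_linear)
  obtain Y where Y: "\<And>n. Y n \<in> field_span f" "(\<lambda>n. \<integral>\<omega>. (X \<omega> - Y n \<omega>)\<^sup>2 \<partial>M) \<longlonglongrightarrow> 0"
    using mean_square_closure_sequence[OF X] by blast
  show ?thesis
  proof (rule gaussian_rv_L2_limit[OF mean_square_closure_second_order[OF X] _ Y(2)])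
    show "second_order_rv M (Y n)" for n
      using V Y(1) by (simp add: linear_rv_space_def)
    show "gaussian_rv M (Y n)" for n
      using f Y(1)[of n] by (auto simp: field_span_def gaussian_field_def)
  qed
qed

lemma (in prob_space) centered_mean_square_closure_field_span:
  assumes f: "second_order_field M f" and zero: "\<And>x. expectation (f x) = 0"
    and X: "X \<in> mean_square_closure M (field_span f)"
  shows "expectation X = 0"
proof -
  obtain Y where Y: "\<And>n. Y n \<in> field_span f" "(\<lambda>n. \<integral>\<omega>. (X \<omega> - Y n \<omega>)\<^sup>2 \<partial>M) \<longlonglongrightarrow> 0"
    using mean_square_closure_sequence[OF X] by blast
  have "second_order_rv M (Y n)" for n
    using field_span_linear[OF f] Y(1) by (simp add: linear_rv_space_def)
  then have "(\<lambda>n. expectation (Y n)) \<longlonglongrightarrow> expectation X"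
    using expectation_tendsto_L2[OF mean_square_closure_second_order[OF X] _ Y(2)] by blast
  moreover have "expectation (Y n) = 0" for n
  proof -
    have "integrable M (f x)" for x
      using f by (intro second_order_rv_integrable) (simp add: second_order_field_def)
    then show ?thesis
      using Y(1)[of n] zero by (auto simp: field_span_def)
  qed
  ultimately show ?thesis
    by (simp add: LIMSEQ_const_iff)
qed

section \<open>The Taylor approximation\<close>

text \<open>
  At a fixed point \<open>x\<close> the approximation is linear in the entries of \<open>g\<close>, \<open>H11\<close> and \<open>H12\<close>
  with deterministic coefficients.
\<close>

lemma skew_taylor2_in_linear_rv_space:
  assumes V: "linear_rv_space M V"
    and g: "\<And>i. (\<lambda>\<omega>. g \<omega> $ i) \<in> V"
    and H11: "\<And>i j. (\<lambda>\<omega>. H11 \<omega> $ i $ j) \<in> V"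
    and H12: "\<And>i j. (\<lambda>\<omega>. H12 \<omega> $ i $ j) \<in> V"
  shows "skew_taylor2 zs g H11 H12 x \<in> V"
proof -
  define v w where "v = fst x - zs" and "w = snd x - zs"
  have bilinear: "(\<lambda>\<omega>. a \<bullet> (H \<omega> *v b)) \<in> V" if H: "\<And>i j. (\<lambda>\<omega>. H \<omega> $ i $ j) \<in> V"
    for H :: "_ \<Rightarrow> real^_^_" and a b
  proof -
    have "(\<lambda>\<omega>. \<Sum>i\<in>UNIV. a $ i * (\<Sum>j\<in>UNIV. b $ j * H \<omega> $ i $ j)) \<in> V"
      by (intro linear_rv_space_sum[OF V] H)
    then show ?thesis
      by (simp add: inner_vec_def matrix_vector_mult_def mult.commute)
  qed
  have linear: "(\<lambda>\<omega>. g \<omega> \<bullet> (v - w)) \<in> V"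
    using linear_rv_space_sum[OF V g, where I = UNIV and c = "\<lambda>i. (v - w) $ i"]
    by (simp add: inner_vec_def mult.commute)
  \<comment> \<open>The factors \<open>1\<close> give every sum the form \<open>a X + b Y\<close> of a binary linear combination.\<close>
  have "(\<lambda>\<omega>. 1 * (1 * (g \<omega> \<bullet> (v - w))
      + 1 * (1/2 * (v \<bullet> (H11 \<omega> *v v)) + (-1/2) * (w \<bullet> (H11 \<omega> *v w))))
      + 1 * (v \<bullet> (H12 \<omega> *v w))) \<in> V"
    by (intro linear_rv_space_linear[OF V] linear bilinear H11 H12)
  moreover have "skew_taylor2 zs g H11 H12 x = (\<lambda>\<omega>. 1 * (1 * (g \<omega> \<bullet> (v - w))
      + 1 * (1/2 * (v \<bullet> (H11 \<omega> *v v)) + (-1/2) * (w \<bullet> (H11 \<omega> *v w))))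
      + 1 * (v \<bullet> (H12 \<omega> *v w)))"
    by (simp add: fun_eq_iff skew_taylor2_def Let_def flip: v_def w_def)
  ultimately show ?thesis by simp
qed

theorem proposition18:
  fixes M :: "'w measure"
    and f :: "(real^'d) \<times> (real^'d) \<Rightarrow> 'w \<Rightarrow> real"
    and zs :: "real^'d"
    and g :: "'w \<Rightarrow> real^'d"
    and H11 H12 :: "'w \<Rightarrow> real^'d^'d"
  assumes "prob_space M"
    and "gaussian_field M f"
    and "skew_symmetric_field M f"
    and "twice_ms_differentiable M f"
    and "\<And>i. has_ms_deriv M f (dir1 i) (zs, zs) (\<lambda>\<omega>. g \<omega> $ i)"
    and "\<And>i j. has_ms_deriv2 M f (dir1 i) (dir1 j) (zs, zs) (\<lambda>\<omega>. H11 \<omega> $ i $ j)"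
    and "\<And>i j. has_ms_deriv2 M f (dir1 i) (dir2 j) (zs, zs) (\<lambda>\<omega>. H12 \<omega> $ i $ j)"
  shows "gaussian_field M (skew_taylor2 zs g H11 H12) \<and>
    ((\<forall>x. prob_space.expectation M (f x) = 0) \<longrightarrow>
     (\<forall>x. prob_space.expectation M (skew_taylor2 zs g H11 H12 x) = 0))"
proof -
  interpret prob_space M by fact
  define W where "W = mean_square_closure M (field_span f)"
  have f2: "second_order_field M f"
    using assms(2) by (simp add: gaussian_field_def)
  note V = field_span_linear[OF f2]
  have W: "linear_rv_space M W"
    unfolding W_def by (rule mean_square_closure_linear_rv_space[OF V])
  have fW: "f y \<in> mean_square_closure M (field_span f)" for y
    by (rule mean_square_closure_incl[OF V field_in_field_span])
  have taylor: "skew_taylor2 zs g H11 H12 x \<in> W" for x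
  proof (rule skew_taylor2_in_linear_rv_space[OF W])
    show "(\<lambda>\<omega>. g \<omega> $ i) \<in> W" for i
      unfolding W_def by (rule has_ms_deriv_in_mean_square_closure[OF V fW assms(5)])
    show "(\<lambda>\<omega>. H11 \<omega> $ i $ j) \<in> W" for i j
      unfolding W_def by (rule has_ms_deriv2_in_mean_square_closure[OF V fW assms(6)])
    show "(\<lambda>\<omega>. H12 \<omega> $ i $ j) \<in> W" for i j
      unfolding W_def by (rule has_ms_deriv2_in_mean_square_closure[OF V fW assms(7)])
  qed
  have "gaussian_field M (skew_taylor2 zs g H11 H12)"
    unfolding gaussian_field_def second_order_field_def
  proof (intro conjI allI impI)
    show "second_order_rv M (skew_taylor2 zs g H11 H12 x)" for x
      using W taylor by (simp add: linear_rv_space_def)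
    show "gaussian_rv M (\<lambda>\<omega>. \<Sum>x\<in>S. c x * skew_taylor2 zs g H11 H12 x \<omega>)" for S c
      using linear_rv_space_sum[OF W taylor] unfolding W_def
      by (rule gaussian_rv_mean_square_closure_field_span[OF assms(2)])
  qed
  moreover have "expectation (skew_taylor2 zs g H11 H12 x) = 0"
    if "\<forall>x. expectation (f x) = 0" for x
    by (rule centered_mean_square_closure_field_span[OF f2 spec[OF that] taylor[unfolded W_def]])
  ultimately show ?thesis by blast
qed

end
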